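(* Let $n\ge 3$ be an integer and let $(A_k)_{k\in\mathbb{Z}}$ be a direct convex polygonal family (CPD) with $n$ vertices in the plane. Suppose that for every $k\in\mathbb{Z}$ the vectors $\overrightarrow{A_{k-1}A_k}$ and $\overrightarrow{A_kA_{k+1}}$ are not in the same quadrant (that is, no one of the four closed quadrants $Q_1,Q_2,Q_3,Q_4$ contains both vectors). Then $n\le 4$.
   Context: The plane is the oriented real affine plane with a fixed direct frame $(O,i,j)$, identified with $\mathbb{R}^2$. For vectors $V=(a,b)$ and $W=(c,d)$, $\det(V,W)=ad-bc$. Quadrants (as sets of nonzero vectors $(x,y)$): $Q_1=\{x\ge 0,\ y\ge 0\}$, $Q_2=\{x\le 0,\ y\ge 0\}$, $Q_3=\{x\le 0,\ y\le 0\}$, $Q_4=\{x\ge 0,\ y\le 0\}$. They are closed, so a nonzero vector on a coordinate axis belongs to two quadrants. Direct convex polygonal family (CPD) with $n$ vertices, $n\ge 3$: a family $(A_k)_{k\in\mathbb{Z}}$ of points of the plane such that (1) $A_{p+n}=A_p$ for all $p\in\mathbb{Z}$; (2) for all $p\in\{0,\dots,n-1\}$ and all $q\in\{1,\dots,n-1\}\setminus\{p,p+1\}$, $\det(\overrightarrow{A_pA_{p+1}},\overrightarrow{A_pA_q})>0$. *)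

theory Defs
  imports Complex_Main "HOL-Analysis.Product_Vector"
begin

type_synonym point = "real \<times> real"

definition det2 :: "point \<Rightarrow> point \<Rightarrow> real" where
  "det2 V W = fst V * snd W - snd V * fst W"

definition Q1 :: "point set" where
  "Q1 = {(x, y). (x, y) \<noteq> (0, 0) \<and> x \<ge> 0 \<and> y \<ge> 0}"

definition Q2 :: "point set" where
  "Q2 = {(x, y). (x, y) \<noteq> (0, 0) \<and> x \<le> 0 \<and> y \<ge> 0}"

definition Q3 :: "point set" where
  "Q3 = {(x, y). (x, y) \<noteq> (0, 0) \<and> x \<le> 0 \<and> y \<le> 0}"

definition Q4 :: "point set" where
  "Q4 = {(x, y). (x, y) \<noteq> (0, 0) \<and> x \<ge> 0 \<and> y \<le> 0}"

definition same_quadrant :: "point \<Rightarrow> point \<Rightarrow> bool" where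
  "same_quadrant V W \<longleftrightarrow> (\<exists>Q \<in> {Q1, Q2, Q3, Q4}. V \<in> Q \<and> W \<in> Q)"

text \<open>Direct convex polygonal families. The index \<open>q = 0\<close> is deliberately not in the
  range of the second condition.\<close>

definition CPD :: "nat \<Rightarrow> (int \<Rightarrow> point) \<Rightarrow> bool" where
  "CPD n A \<longleftrightarrow> n \<ge> 3 \<and>
     (\<forall>p. A (p + int n) = A p) \<and>
     (\<forall>p \<in> {0..int n - 1}. \<forall>q \<in> {1..int n - 1} - {p, p + 1}.
        det2 (A (p + 1) - A p) (A q - A p) > 0)"

end

(* Since consecutive edges never share a closed quadrant, at every vertex one of the four functionals
   x, -x, y, -y has a strict local minimum among the neighbouring vertices. By convexity
   the polygon lies in the cone spanned at a vertex by its two edges, so a strict local minimum of a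
   linear functional is a global one, and each functional has it at one vertex only: n \<le> 4. *)
theory Submission
  imports Defs
begin

lemma det2_bilinear:
  "det2 (U + V) W = det2 U W + det2 V W"
  "det2 W (U + V) = det2 W U + det2 W V"
  "det2 (U - V) W = det2 U W - det2 V W"
  "det2 W (U - V) = det2 W U - det2 W V"
  by (simp_all add: det2_def algebra_simps)

lemma det2_self [simp]: "det2 V V = 0"
  by (simp add: det2_def)

lemma det2_swap: "det2 W V = - det2 V W"
  by (simp add: det2_def)

text \<open>With one vector read as a linear functional, this is Cramer's rule; with four
  directions, it makes orientations compose.\<close>

lemma det2_pluecker:
  "det2 P Q * det2 R S = det2 P R * det2 Q S - det2 P S * det2 Q R"
  by (simp add: det2_def algebra_simps)

text \<open>\<open>W\<close> encodes the linear functional \<open>det2 W\<close>. Every linear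
  functional on the plane has this form, so determinant identities apply directly to its
  values.\<close>

definition strict_local_min :: "(int \<Rightarrow> point) \<Rightarrow> point \<Rightarrow> int \<Rightarrow> bool" where
  "strict_local_min A W k \<longleftrightarrow>
     det2 W (A k) < det2 W (A (k - 1)) \<and> det2 W (A k) < det2 W (A (k + 1))"

text \<open>If neither coordinate strictly changes sign between the two edges, some closed quadrant
  contains both. A change from negative to positive gives a minimum of that coordinate at
  \<open>k\<close>, the opposite change a minimum of its negative. The determinant ensures that both
  edges are nonzero.\<close>

lemma ex_axis_strict_local_min:
  assumes "\<not> same_quadrant (A k - A (k - 1)) (A (k + 1) - A k)"
    and "det2 (A k - A (k - 1)) (A (k + 1) - A k) > 0"
  shows "\<exists>W \<in> {(1, 0), (-1, 0), (0, 1), (0, -1)}. strict_local_min A W k"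
proof -
  obtain a b where v: "A k - A (k - 1) = (a, b)" by fastforce
  obtain c d where u: "A (k + 1) - A k = (c, d)" by fastforce
  have nz: "(a, b) \<noteq> (0, 0)" "(c, d) \<noteq> (0, 0)"
    using assms(2) unfolding v u by (auto simp: det2_def)
  have "b < 0 \<and> 0 < d \<or> d < 0 \<and> 0 < b \<or> c < 0 \<and> 0 < a \<or> a < 0 \<and> 0 < c"
  proof (rule ccontr)
    assume "\<not> ?thesis"
    then have "0 \<le> b \<and> 0 \<le> d \<or> b \<le> 0 \<and> d \<le> 0" "0 \<le> a \<and> 0 \<le> c \<or> a \<le> 0 \<and> c \<le> 0"
      by linarith+
    then have "same_quadrant (a, b) (c, d)"
      using nz by (auto simp: same_quadrant_def Q1_def Q2_def Q3_def Q4_def)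
    then show False using assms(1) unfolding v u by simp
  qed
  moreover have "fst (A k) - fst (A (k - 1)) = a" "snd (A k) - snd (A (k - 1)) = b"
    "fst (A (k + 1)) - fst (A k) = c" "snd (A (k + 1)) - snd (A k) = d"
    by (simp_all flip: fst_diff snd_diff add: v u)
  ultimately show ?thesis
    unfolding strict_local_min_def det2_def by auto
qed

lemma CPD_edge_out:
  assumes "CPD n A" "p \<in> {0..int n - 1}" "q \<in> {1..int n - 1}" "q \<noteq> p" "q \<noteq> p + 1"
  shows "det2 (A (p + 1) - A p) (A q - A p) > 0"
  using assms unfolding CPD_def by blast

lemma CPD_periodic: "CPD n A \<Longrightarrow> A (p + int n) = A p"
  unfolding CPD_def by blast

lemma CPD_wrap:
  assumes "CPD n A"
  shows "A (- 1) = A (int n - 1)" "A (int n) = A 0"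
  using CPD_periodic[OF assms, of "-1"] CPD_periodic[OF assms, of 0] by simp_all

text \<open>The exception compares points, not indices, because for \<open>k = 0\<close> the vertex
  \<open>k - 1\<close> is the vertex \<open>int n - 1\<close>.\<close>

lemma CPD_edge_in:
  assumes "CPD n A" "k \<in> {0..int n - 1}" "q \<in> {1..int n - 1}" "q \<noteq> k"
    and "A q \<noteq> A (k - 1)"
  shows "det2 (A k - A (k - 1)) (A q - A k) > 0"
proof -
  have "det2 (A k - A (k - 1)) (A q - A (k - 1)) > 0"
  proof (cases "k = 0")
    case True
    then show ?thesis
      using CPD_edge_out[OF assms(1), of "int n - 1" q] assms CPD_wrap[OF assms(1)] by auto
  next
    case False
    then show ?thesis
      using CPD_edge_out[OF assms(1), of "k - 1" q] assms by auto
  qed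
  moreover have "det2 (A k - A (k - 1)) (A q - A (k - 1)) = det2 (A k - A (k - 1)) (A q - A k)"
    by (simp add: det2_def algebra_simps)
  ultimately show ?thesis by simp
qed

lemma CPD_consecutive_edges:
  assumes "CPD n A" "k \<in> {0..int n - 1}"
  shows "det2 (A k - A (k - 1)) (A (k + 1) - A k) > 0"
proof -
  have n: "n \<ge> 3" using assms(1) by (simp add: CPD_def)
  show ?thesis
  \<comment> \<open>The tested index must lie in \<open>{1..int n - 1}\<close>. For the last
    \<open>k\<close> the next vertex is vertex 0, so the outgoing edge is tested against
    \<open>k - 1\<close>; otherwise the incoming edge is tested against
    \<open>k + 1\<close>.\<close>
  proof (cases "k = int n - 1")
    case True
    have "det2 (A (k + 1) - A k) (A (k - 1) - A k) > 0"
      using CPD_edge_out[OF assms, of "k - 1"] True n by auto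
    then show ?thesis by (simp add: det2_def algebra_simps)
  next
    case False
    have "det2 (A k - A (k - 1)) (A (k + 1) - A (k - 1)) > 0"
    proof (cases "k = 0")
      case True
      then show ?thesis
        using CPD_edge_out[OF assms(1), of "int n - 1" 1] CPD_wrap[OF assms(1)] n by auto
    next
      case nz: False
      then show ?thesis
        using CPD_edge_out[OF assms(1), of "k - 1" "k + 1"] assms(2) False by auto
    qed
    then show ?thesis by (simp add: det2_def algebra_simps)
  qed
qed

lemma strict_local_min_less:
  assumes "CPD n A" "k \<in> {0..int n - 1}" "q \<in> {1..int n - 1}" "q \<noteq> k"
    and min: "strict_local_min A W k"
  shows "det2 W (A k) < det2 W (A q)"
proof -
  let ?u = "A (k + 1) - A k" and ?v = "A k - A (k - 1)" and ?w = "A q - A k"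
  consider "q = k + 1" | "A q = A (k - 1)" | "q \<noteq> k + 1" "A q \<noteq> A (k - 1)" by blast
  then show ?thesis
  proof cases
    case 3
    have uw: "det2 ?u ?w > 0" using CPD_edge_out[OF assms(1-4) 3(1)] .
    have vw: "det2 ?v ?w > 0" using CPD_edge_in[OF assms(1-4) 3(2)] .
    have vu: "det2 ?v ?u > 0" using CPD_consecutive_edges[OF assms(1,2)] .
    have f: "det2 W ?u > 0" "det2 W ?v < 0"
      using min by (simp_all add: strict_local_min_def det2_bilinear)
    \<comment> \<open>Cramer's rule: \<open>?w\<close> is a positive combination of
      \<open>?u\<close> and \<open>- ?v\<close>, and the functional is positive on both.\<close>
    have "det2 W ?w * det2 ?v ?u = det2 ?v ?w * det2 W ?u - det2 ?u ?w * det2 W ?v"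
      unfolding det2_pluecker[of W ?w ?v ?u] det2_swap[of ?w ?u] det2_swap[of ?w ?v] by argo
    also have "\<dots> > 0"
      using mult_pos_pos[OF vw f(1)] mult_pos_neg[OF uw f(2)] by linarith
    finally have "det2 W ?w > 0" using vu by (simp add: zero_less_mult_iff)
    then show ?thesis by (simp add: det2_bilinear)
  qed (use min in \<open>auto simp: strict_local_min_def\<close>)
qed

text \<open>Seen from vertex 1, consecutive later vertices turn counterclockwise because vertex 1
  lies to the left of the edge joining them. These turns compose because vertices 3 to
  \<open>int n - 1\<close> all lie to the left of the edge from 1 to 2.\<close>

lemma CPD_fan_from_1:
  assumes "CPD n A" "2 \<le> p" "p < q" "q \<le> int n - 1"
  shows "det2 (A p - A 1) (A q - A 1) > 0"
  using assms(3,4)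
proof (induction q rule: int_gr_induct)
  case base
  have "det2 (A (p + 1) - A p) (A 1 - A p) > 0"
    using CPD_edge_out[OF assms(1), of p 1] assms(2) base by auto
  then show ?case by (simp add: det2_def algebra_simps)
next
  case (step q)
  let ?d = "\<lambda>i j. det2 (A i - A 1) (A j - A 1)"
  have two: "?d 2 j > 0" if "2 < j" "j \<le> int n - 1" for j
    using CPD_edge_out[OF assms(1), of 1 j] that by auto
  have pq: "?d p q > 0" using step by simp
  have "det2 (A (q + 1) - A q) (A 1 - A q) > 0"
    using CPD_edge_out[OF assms(1), of q 1] assms(2) step by auto
  then have qq: "?d q (q + 1) > 0" by (simp add: det2_def algebra_simps)
  show ?case
  proof (cases "p = 2")
    case True
    then show ?thesis using two step by simp
  next
    case False
    then have pos: "?d 2 p > 0" "?d 2 q > 0" "?d 2 (q + 1) > 0"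
      using two assms(2) step by simp_all
    have "?d 2 q * ?d p (q + 1) = ?d 2 p * ?d q (q + 1) + ?d 2 (q + 1) * ?d p q"
      by (simp add: det2_pluecker[of "A 2 - A 1" "A p - A 1" "A q - A 1" "A (q + 1) - A 1"])
    also have "\<dots> > 0" using pos pq qq by (simp add: add_pos_pos)
    finally show ?thesis using pos by (simp add: zero_less_mult_iff)
  qed
qed

(* CPD says nothing about the position of vertex 0 relative to the edges from p to p + 1 with
   1 < p < n - 2, so vertex 0 is handled by hand: vertex k lies in the cone at vertex 0 spanned by
   its neighbours, beyond the line joining them, hence is above the lower of the two. *)
lemma strict_local_min_not_with_0:
  assumes "CPD n A" "k \<in> {1..int n - 1}"
    and min0: "strict_local_min A W 0" and mink: "strict_local_min A W k"
  shows False
proof -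
  have n: "n \<ge> 3" using assms(1) by (simp add: CPD_def)
  note wrap = CPD_wrap[OF assms(1)]
  have above0: "det2 W (A 0) < det2 W (A k)"
    using strict_local_min_less[OF assms(1) _ assms(2) _ min0] assms(2) by auto
  have k: "2 \<le> k" "k < int n - 1"
  proof -
    have "k \<noteq> 1" using above0 mink by (auto simp: strict_local_min_def)
    moreover have "k \<noteq> int n - 1" using above0 mink wrap by (auto simp: strict_local_min_def)
    ultimately show "2 \<le> k" "k < int n - 1" using assms(2) by auto
  qed
  define m where "m = int n - 1"
  define p q w where "p = A 1 - A 0" and "q = A m - A 0" and "w = A k - A 0"
  have "det2 (A 1 - A 0) (A k - A 0) > 0" "det2 (A 1 - A 0) (A m - A 0) > 0"
    using CPD_edge_out[OF assms(1), of 0 k] CPD_edge_out[OF assms(1), of 0 m] k by (auto simp: m_def)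
  then have pw: "det2 p w > 0" and pq: "det2 p q > 0" by (simp_all add: p_def q_def w_def)
  have "det2 (A 0 - A m) (A k - A m) > 0"
    using CPD_edge_out[OF assms(1), of m k] k wrap by (auto simp: m_def)
  then have wq: "det2 w q > 0" by (simp add: q_def w_def det2_def algebra_simps)
  have "det2 (A k - A 1) (A m - A 1) > 0"
    using CPD_fan_from_1[OF assms(1) k(1) k(2)] by (simp add: m_def)
  \<comment> \<open>In the basis \<open>p\<close>, \<open>q\<close> the coefficients of
    \<open>w\<close> are \<open>det2 w q\<close> and \<open>det2 p w\<close>, each divided by
    \<open>det2 p q\<close>; so their sum exceeds 1.\<close>
  then have beyond: "det2 p w + det2 w q > det2 p q"
    by (simp add: p_def q_def w_def det2_def algebra_simps)
  have fw: "det2 W w > 0" using above0 by (simp add: w_def det2_bilinear)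
  have fp: "det2 W p > det2 W w" and fq: "det2 W q > det2 W w"
    using strict_local_min_less[OF assms(1) _ _ _ mink, of 1]
      strict_local_min_less[OF assms(1) _ _ _ mink, of m] k
    by (auto simp: p_def q_def w_def m_def det2_bilinear)
  \<comment> \<open>With \<open>w\<close> written in the basis \<open>p\<close>, \<open>q\<close>,
    its value would exceed the coefficient sum times itself, hence itself, as that value is
    positive.\<close>
  have "det2 W w * det2 p q < det2 W w * (det2 p w + det2 w q)"
    using fw beyond by simp
  also have "\<dots> < det2 W q * det2 p w + det2 W p * det2 w q"
    using mult_strict_right_mono[OF fq pw] mult_strict_right_mono[OF fp wq]
    by (simp add: algebra_simps)
  also have "\<dots> = det2 W w * det2 p q"
    by (simp add: det2_def algebra_simps)
  finally show False by simp
qed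

text \<open>Of two minima at nonzero indices, each would lie strictly below the other; index 0 needs
  the preceding lemma.\<close>

lemma strict_local_min_unique:
  assumes "CPD n A" "k \<in> {0..int n - 1}" "l \<in> {0..int n - 1}"
    and "strict_local_min A W k" "strict_local_min A W l"
  shows "k = l"
proof (rule ccontr)
  assume "k \<noteq> l"
  moreover have "k \<noteq> 0" "l \<noteq> 0"
    using strict_local_min_not_with_0[OF assms(1), of l W]
      strict_local_min_not_with_0[OF assms(1), of k W] assms \<open>k \<noteq> l\<close> by auto
  ultimately show False
    using strict_local_min_less[OF assms(1,2) _ _ assms(4), of l]
      strict_local_min_less[OF assms(1,3) _ _ assms(5), of k] assms(2,3) by auto
qed

theorem mainTheorem1:
  fixes n :: nat and A :: "int \<Rightarrow> point"
  assumes "n \<ge> 3"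
    and "CPD n A"
    and "\<And>k. \<not> same_quadrant (A k - A (k - 1)) (A (k + 1) - A k)"
  shows "n \<le> 4"
proof -
  define S :: "point set" where "S = {(1, 0), (-1, 0), (0, 1), (0, -1)}"
  have "\<forall>k \<in> {0..int n - 1}. \<exists>W \<in> S. strict_local_min A W k"
    using ex_axis_strict_local_min assms(3) CPD_consecutive_edges[OF assms(2)]
    unfolding S_def by blast
  then obtain g where g: "\<And>k. k \<in> {0..int n - 1} \<Longrightarrow> g k \<in> S \<and> strict_local_min A (g k) k"
    by metis
  have "inj_on g {0..int n - 1}"
    by (rule inj_onI) (metis g strict_local_min_unique[OF assms(2)])
  moreover have "g ` {0..int n - 1} \<subseteq> S" using g by blast
  moreover have "finite S" by (simp add: S_def)
  ultimately have "card {0..int n - 1} \<le> card S" by (rule card_inj_on_le)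
  also have "card S \<le> 4"
    unfolding S_def by (simp add: card_insert_if)
  finally show ?thesis by simp
qed

end
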